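(* Let $V$ be a Banach space, let $S(t)$, $t\ge 0$, be a proper family of bounded linear operators on $V$ and let $A=DS$. Let $(t_i^n)_{1\le i\le r_n}$, $n\in\mathbb N$, be positive numbers such that $\sum_{i=1}^{r_n}t_i^n\to t\ge 0$ and $\max_i t_i^n\to 0$ as $n\to\infty$. Then, for all $f\in V$, $$S(t_1^n)\cdots S(t_{r_n}^n)f\longrightarrow e^{tA}f\qquad (n\to\infty).$$
   Context: $B(V)$ is the space of bounded linear operators on $V$. A strongly continuous family $S:[0,\infty)\to B(V)$ with $S(0)=I$ is called proper if (i) $\|S(t)\|=1+O(t)$ as $t\downarrow 0$, and (ii) there is an operator $(A,\mathcal D(A))$ which is the generator of a strongly continuous semigroup $(e^{tA})$ on $V$ such that $\frac{S(t)-I}{t}f\to Af$ as $t\downarrow 0$ for all $f\in V$ of the form $f=e^{aA}g$ with $a>0$ and $g\in V$. The operator $(A,\mathcal D(A))$ is uniquely determined by $S$ and denoted $DS$. *)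

theory Defs
  imports "HOL-Analysis.Analysis" "HOL-Library.Landau_Symbols"
begin

definition strongly_continuous :: "(real \<Rightarrow> 'a::banach \<Rightarrow>\<^sub>L 'a) \<Rightarrow> bool" where
  "strongly_continuous T \<longleftrightarrow> (\<forall>f. continuous_on {0..} (\<lambda>t. T t f))"

definition C0_semigroup :: "(real \<Rightarrow> 'a::banach \<Rightarrow>\<^sub>L 'a) \<Rightarrow> bool" where
  "C0_semigroup T \<longleftrightarrow>
     T 0 = id_blinfun \<and>
     (\<forall>s\<ge>0. \<forall>t\<ge>0. T (s + t) = T s o\<^sub>L T t) \<and>
     strongly_continuous T"

text \<open>An unbounded operator is represented by its graph, so that two operators
  are equal iff both their domains and their values agree: \<open>(f, h) \<in> A\<close> means that
  \<open>f\<close> lies in the domain of \<open>A\<close> and \<open>A f = h\<close>; the domain is \<open>Domain A\<close>.\<close>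

definition generator :: "(real \<Rightarrow> 'a::banach \<Rightarrow>\<^sub>L 'a) \<Rightarrow> ('a \<times> 'a) set" where
  "generator T = {(f, h). ((\<lambda>t. (T t f - f) /\<^sub>R t) \<longlongrightarrow> h) (at_right 0)}"

lemma single_valued_generator: "single_valued (generator T)"
  unfolding single_valued_def generator_def
  by (auto intro: tendsto_unique[OF trivial_limit_at_right_real])

text \<open>\<open>generates A T\<close>: for \<open>t \<ge> 0\<close>, \<open>T t\<close> is the operator written \<open>e\<^sup>t\<^sup>A\<close>.
  Arguments \<open>t < 0\<close> are unconstrained, here and for families of operators below.\<close>

definition generates :: "('a \<times> 'a) set \<Rightarrow> (real \<Rightarrow> 'a::banach \<Rightarrow>\<^sub>L 'a) \<Rightarrow> bool" where
  "generates A T \<longleftrightarrow> C0_semigroup T \<and> generator T = A"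

text \<open>\<open>has_D S A\<close> says \<open>A = DS\<close>. As \<open>A f\<close> is
  meaningful only for \<open>f\<close> in the domain, the condition includes that every
  \<open>f = e\<^sup>a\<^sup>A g\<close> with \<open>a > 0\<close> lies in the domain of \<open>A\<close>.\<close>

definition has_D :: "(real \<Rightarrow> 'a::banach \<Rightarrow>\<^sub>L 'a) \<Rightarrow> ('a \<times> 'a) set \<Rightarrow> bool" where
  "has_D S A \<longleftrightarrow>
     (\<exists>T. generates A T \<and>
       (\<forall>a>0. \<forall>g f. f = T a g \<longrightarrow>
         (\<exists>h. (f, h) \<in> A \<and> ((\<lambda>t. (S t f - f) /\<^sub>R t) \<longlongrightarrow> h) (at_right 0))))"

definition proper_family :: "(real \<Rightarrow> 'a::banach \<Rightarrow>\<^sub>L 'a) \<Rightarrow> bool" where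
  "proper_family S \<longleftrightarrow>
     strongly_continuous S \<and>
     S 0 = id_blinfun \<and>
     (\<lambda>t. norm (S t) - 1) \<in> O[at_right 0](\<lambda>t. t) \<and>
     (\<exists>A. has_D S A)"

text \<open>\<open>op_product S \<tau> r = S (\<tau> 1) o\<^sub>L \<dots> o\<^sub>L S (\<tau> r)\<close>\<close>

definition op_product ::
    "(real \<Rightarrow> 'a::banach \<Rightarrow>\<^sub>L 'a) \<Rightarrow> (nat \<Rightarrow> real) \<Rightarrow> nat \<Rightarrow> 'a \<Rightarrow>\<^sub>L 'a" where
  "op_product S \<tau> r = foldr (\<lambda>i U. S (\<tau> i) o\<^sub>L U) [1..<Suc r] id_blinfun"

end

theory Submission
  imports Defs
begin

text \<open>A Chernoff/Lax argument. Writing the difference of \<open>S t\<^sub>1 \<dots> S t\<^sub>r g\<close> and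
  \<open>T (t\<^sub>1 + \<dots> + t\<^sub>r) g\<close> as a telescoping sum, each summand is a stable product applied to a
  one-step error \<open>(S x - T x) (T s g)\<close>. For \<open>g\<close> in the range of some \<open>T a\<close> with \<open>a > 0\<close> this
  error is \<open>o(x)\<close> uniformly in \<open>s\<close>, so the sum tends to 0; stability and the density of these
  ranges extend the convergence to all vectors. The semigroup in the definition of \<open>DS\<close> is
  existentially quantified; it coincides with the given one by the same convergence result,
  applied with one semigroup in the role of \<open>S\<close> and equal time steps.\<close>

section \<open>Uniform boundedness and uniform convergence on compact sets\<close>

text \<open>By Baire, one of the closed sets \<open>E n\<close>, which cover the space, contains a
  ball; linearity turns the bound on that ball into a bound on operator norms.\<close>

lemma banach_steinhaus:
  fixes B :: "'i \<Rightarrow> 'a::banach \<Rightarrow>\<^sub>L 'b::real_normed_vector"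
  assumes "\<And>x. bounded ((\<lambda>i. B i x) ` I)"
  shows "\<exists>L. \<forall>i\<in>I. norm (B i) \<le> L"
proof -
  define E where "E n = {x. \<forall>i\<in>I. norm (B i x) \<le> real n}" for n
  have closed_E: "closed (E n)" for n
  proof -
    have "E n = (\<Inter>i\<in>I. {x. norm (B i x) \<le> real n})"
      unfolding E_def by auto
    moreover have "closed {x. norm (B i x) \<le> real n}" for i
      by (intro closed_Collect_le continuous_intros)
    ultimately show ?thesis
      by auto
  qed
  have "\<exists>n. x \<in> E n" for x
  proof -
    obtain b where "\<forall>i\<in>I. norm (B i x) \<le> b"
      using assms[of x] unfolding bounded_iff by auto
    moreover obtain n where "b \<le> real n"
      using real_arch_simple by blast
    ultimately show ?thesis
      unfolding E_def by (intro exI[of _ n]) (auto intro: order.trans)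
  qed
  then have "\<Union>(range E) = UNIV"
    by blast
  have "\<exists>n. interior (E n) \<noteq> {}"
  proof (rule ccontr)
    assume "\<nexists>n. interior (E n) \<noteq> {}"
    then have "euclidean interior_of \<Union>(range E) = {}"
      using closed_E
      by (intro Baire_category_alt) (auto simp: completely_metrizable_space_euclidean)
    then show False
      using \<open>\<Union>(range E) = UNIV\<close> by simp
  qed
  then obtain n x0 e where "e > 0" and ball: "cball x0 e \<subseteq> E n"
    by (meson ex_in_conv mem_interior_cball)
  show ?thesis
  proof (intro exI ballI)
    fix i assume i: "i \<in> I"
    show "norm (B i) \<le> 2 * real n / e"
    proof (rule norm_blinfun_bound)
      fix x
      show "norm (B i x) \<le> 2 * real n / e * norm x"
      proof (cases "x = 0")
        case False
        \<comment> \<open>Rescaling \<open>x\<close> to norm \<open>e\<close> keeps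
          \<open>x0 + y\<close> in the ball. Since \<open>y\<close> is the difference of
          \<open>x0 + y\<close> and \<open>x0\<close>, both in \<open>E n\<close>, its image has
          norm at most \<open>2 * n\<close>.\<close>
        define y where "y = (e / norm x) *\<^sub>R x"
        have "norm y = e"
          using False \<open>e > 0\<close> by (simp add: y_def)
        then have "x0 + y \<in> E n" "x0 \<in> E n"
          using ball \<open>e > 0\<close> by (auto simp: subset_iff dist_norm)
        then have "norm (B i (x0 + y)) \<le> n" "norm (B i x0) \<le> n"
          using i by (auto simp: E_def)
        moreover have "norm (B i y) \<le> norm (B i (x0 + y)) + norm (B i x0)"
          by (metis add_diff_cancel_left' blinfun.diff_right norm_triangle_ineq4)
        ultimately have "norm (B i y) \<le> 2 * n"
          by linarith
        moreover have "norm (B i y) = e / norm x * norm (B i x)"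
          using \<open>e > 0\<close> by (simp add: y_def blinfun.scaleR_right)
        ultimately show ?thesis
          using False \<open>e > 0\<close> by (simp add: field_simps)
      qed simp
    qed (use \<open>e > 0\<close> in simp)
  qed
qed

text \<open>Pointwise convergence is uniform on a finite net of \<open>K\<close>, and the common
  norm bound controls the distance from any point to the net.\<close>

lemma strongly_convergent_imp_uniform_limit_on_compact:
  fixes B :: "'i \<Rightarrow> 'a::real_normed_vector \<Rightarrow>\<^sub>L 'b::real_normed_vector"
  assumes "compact K"
    and bound: "eventually (\<lambda>i. norm (B i) \<le> L) F"
    and lim: "\<And>x. ((\<lambda>i. B i x) \<longlongrightarrow> 0) F"
  shows "uniform_limit K (\<lambda>i x. B i x) (\<lambda>_. 0) F"
proof (rule uniform_limitI)
  fix e :: real assume "e > 0"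
  \<comment> \<open>With this radius, moving to the nearest net point costs at most
    \<open>e / 2\<close>. Using \<open>\<bar>L\<bar> + 1\<close> makes the denominator positive
    whatever the sign of \<open>L\<close>.\<close>
  define d where "d = e / (2 * (\<bar>L\<bar> + 1))"
  have "d > 0"
    using \<open>e > 0\<close> by (simp add: d_def)
  then obtain C where C: "finite C" "K \<subseteq> (\<Union>c\<in>C. ball c d)"
    using \<open>compact K\<close> unfolding compact_eq_totally_bounded by blast
  have "eventually (\<lambda>i. \<forall>c\<in>C. norm (B i c) < e / 2) F"
    using C(1) tendstoD[OF lim, of "e / 2"] \<open>e > 0\<close>
    by (auto simp: eventually_ball_finite_distrib)
  then show "eventually (\<lambda>i. \<forall>x\<in>K. dist (B i x) 0 < e) F"
    using bound
  proof eventually_elim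
    case (elim i)
    show ?case
    proof
      fix x assume "x \<in> K"
      then obtain c where c: "c \<in> C" "dist c x < d"
        using C(2) by auto
      have "norm (B i (x - c)) \<le> (\<bar>L\<bar> + 1) * norm (x - c)"
        using elim(2) by (intro order.trans[OF norm_blinfun] mult_right_mono) auto
      also have "\<dots> \<le> (\<bar>L\<bar> + 1) * d"
        using c(2) by (intro mult_left_mono) (auto simp: dist_norm norm_minus_commute)
      also have "\<dots> = e / 2"
        by (simp add: d_def field_simps)
      finally have "norm (B i x - B i c) \<le> e / 2"
        by (simp add: blinfun.diff_right)
      moreover have "norm (B i c) < e / 2"
        using elim(1) c(1) by blast
      ultimately show "dist (B i x) 0 < e"
        using norm_triangle_sub[of "B i x" "B i c"] by simp
    qed
  qed
qed

text \<open>Difference quotients are continuous only away from 0, so compactness covers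
  \<open>{d..b}\<close> and the limit covers the points near 0.\<close>

lemma bounded_image_if_tendsto_at_right:
  fixes h :: "real \<Rightarrow> 'b::real_normed_vector"
  assumes "continuous_on {0<..b} h" and "(h \<longlongrightarrow> l) (at_right 0)"
  shows "bounded (h ` {0<..b})"
proof (cases "b > 0")
  case True
  obtain d where "d > 0" and d: "\<And>x. 0 < x \<Longrightarrow> x < d \<Longrightarrow> dist (h x) l < 1"
    using tendstoD[OF assms(2), of 1] by (auto simp: eventually_at_right_field)
  have "bounded (h ` {d..b})"
    using \<open>d > 0\<close>
    by (intro compact_imp_bounded compact_continuous_image continuous_on_subset[OF assms(1)]) auto
  moreover have "h ` {0<..b} \<subseteq> ball l 1 \<union> h ` {d..b}"
    using d by (force simp: dist_commute)
  ultimately show ?thesis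
    by (meson bounded_Un bounded_ball bounded_subset)
qed simp

section \<open>Finite products and strongly continuous semigroups\<close>

text \<open>Lists in place of indexed families let inductions split off a factor at either end. The
  head is the leftmost factor, applied last.\<close>

definition blinfun_prod_list :: "(real \<Rightarrow> 'a::banach \<Rightarrow>\<^sub>L 'a) \<Rightarrow> real list \<Rightarrow> 'a \<Rightarrow>\<^sub>L 'a" where
  "blinfun_prod_list S xs = foldr (\<lambda>x U. S x o\<^sub>L U) xs id_blinfun"

lemma blinfun_prod_list_Nil [simp]: "blinfun_prod_list S [] = id_blinfun"
  by (simp add: blinfun_prod_list_def)

lemma blinfun_prod_list_Cons [simp]:
  "blinfun_prod_list S (x # xs) = S x o\<^sub>L blinfun_prod_list S xs"
  by (simp add: blinfun_prod_list_def)

lemma blinfun_prod_list_append: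
  "blinfun_prod_list S (xs @ ys) = blinfun_prod_list S xs o\<^sub>L blinfun_prod_list S ys"
  by (induction xs) (auto intro!: blinfun_eqI)

lemma op_product_eq_blinfun_prod_list:
  "op_product S \<tau> r = blinfun_prod_list S (map \<tau> [1..<Suc r])"
  by (simp add: op_product_def blinfun_prod_list_def foldr_map comp_def)

lemma C0_semigroup_0: "C0_semigroup T \<Longrightarrow> T 0 = id_blinfun"
  by (simp add: C0_semigroup_def)

lemma C0_semigroup_add:
  "C0_semigroup T \<Longrightarrow> 0 \<le> s \<Longrightarrow> 0 \<le> t \<Longrightarrow> T (s + t) = T s o\<^sub>L T t"
  by (simp add: C0_semigroup_def)

lemma C0_semigroup_continuous_on:
  "C0_semigroup T \<Longrightarrow> continuous_on {0..} (\<lambda>t. T t f)"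
  by (simp add: C0_semigroup_def strongly_continuous_def)

text \<open>Each orbit is bounded on the compact interval by continuity, so Banach-Steinhaus
  applies.\<close>

lemma C0_semigroup_locally_bounded:
  assumes "C0_semigroup T"
  shows "\<exists>M. \<forall>t\<in>{0..K}. norm (T t) \<le> M"
  by (intro banach_steinhaus compact_imp_bounded compact_continuous_image
      continuous_on_subset[OF C0_semigroup_continuous_on[OF assms]]) auto

lemma C0_semigroup_prod_list:
  assumes "C0_semigroup T" and "\<And>x. x \<in> set xs \<Longrightarrow> 0 \<le> x"
  shows "blinfun_prod_list T xs = T (sum_list xs)"
  using assms(2)
proof (induction xs)
  case (Cons x xs)
  then show ?case
    using C0_semigroup_add[OF assms(1), of x "sum_list xs"] by (simp add: sum_list_nonneg)
qed (simp add: C0_semigroup_0[OF assms(1)])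

section \<open>Consistency, stability and convergence of products\<close>

text \<open>Consistency in the sense of Lax. Comparing \<open>S\<close> with \<open>T\<close>
  directly, instead of with the generator, keeps unbounded operators out of the argument.\<close>

definition consistent_with :: "(real \<Rightarrow> 'a::banach \<Rightarrow>\<^sub>L 'a) \<Rightarrow> (real \<Rightarrow> 'a \<Rightarrow>\<^sub>L 'a) \<Rightarrow> bool" where
  "consistent_with S T \<longleftrightarrow>
     (\<forall>a>0. \<forall>g. ((\<lambda>x. (S x (T a g) - T x (T a g)) /\<^sub>R x) \<longlongrightarrow> 0) (at_right 0))"

text \<open>Stability in the sense of Lax: \<open>M\<close> may depend on \<open>K\<close>, but not
  on the number of factors. Steps are restricted to be short because the growth condition on
  \<open>S\<close> controls only small times.\<close>

definition stable_up_to :: "(real \<Rightarrow> 'a::banach \<Rightarrow>\<^sub>L 'a) \<Rightarrow> real \<Rightarrow> bool" where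
  "stable_up_to S K \<longleftrightarrow>
     (\<exists>\<delta>>0. \<exists>M. \<forall>xs. set xs \<subseteq> {0<..<\<delta>} \<and> sum_list xs \<le> K \<longrightarrow> norm (blinfun_prod_list S xs) \<le> M)"

text \<open>The operators \<open>(S x - T x) T a / x\<close> are everywhere defined and bounded, so Banach-Steinhaus
  makes their pointwise convergence to 0 uniform on the compact orbit \<open>{T s g | 0 \<le> s \<le> K}\<close>.\<close>

lemma consistent_uniformly_on_orbit:
  assumes "C0_semigroup T" "strongly_continuous S" "consistent_with S T"
    and "a > 0" "e > 0"
  shows "\<exists>\<delta>>0. \<forall>x\<in>{0<..<\<delta>}. \<forall>s\<in>{0..K}. norm (S x (T (a + s) g) - T x (T (a + s) g)) \<le> e * x"
proof -
  define B where "B x = ((S x - T x) o\<^sub>L T a) /\<^sub>R x" for x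
  have B_apply: "B x h = (S x (T a h) - T x (T a h)) /\<^sub>R x" for x h
    by (simp add: B_def blinfun.scaleR_left blinfun.diff_left)
  have lim: "((\<lambda>x. B x h) \<longlongrightarrow> 0) (at_right 0)" for h
    using assms(3,4) by (simp add: consistent_with_def B_apply)
  have "bounded ((\<lambda>x. B x h) ` {0<..1})" for h
  proof (rule bounded_image_if_tendsto_at_right[OF _ lim])
    have "continuous_on {0<..1} (\<lambda>x. S x h')" "continuous_on {0<..1} (\<lambda>x. T x h')" for h'
      using assms(1,2) unfolding C0_semigroup_def strongly_continuous_def
      by (auto intro: continuous_on_subset[of "{0..}"])
    then show "continuous_on {0<..1} (\<lambda>x. B x h)"
      unfolding B_apply
      by (intro continuous_on_scaleR continuous_on_diff continuous_on_inverse continuous_on_id) auto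
  qed
  then obtain L where L: "\<forall>x\<in>{0<..1}. norm (B x) \<le> L"
    using banach_steinhaus by blast
  have "eventually (\<lambda>x. norm (B x) \<le> L) (at_right 0)"
    using L by (auto simp: eventually_at_right_field intro!: exI[of _ 1])
  moreover have "compact ((\<lambda>s. T s g) ` {0..K})"
    by (intro compact_continuous_image
        continuous_on_subset[OF C0_semigroup_continuous_on[OF assms(1)]]) auto
  ultimately have "uniform_limit ((\<lambda>s. T s g) ` {0..K}) (\<lambda>x h. B x h) (\<lambda>_. 0) (at_right 0)"
    using lim by (intro strongly_convergent_imp_uniform_limit_on_compact)
  then obtain \<delta> where "\<delta> > 0"
    and \<delta>: "\<And>x s. 0 < x \<Longrightarrow> x < \<delta> \<Longrightarrow> s \<in> {0..K} \<Longrightarrow> norm (B x (T s g)) < e"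
    using \<open>e > 0\<close> unfolding uniform_limit_iff eventually_at_right_field by fastforce
  show ?thesis
  proof (intro exI[of _ \<delta>] conjI ballI \<open>\<delta> > 0\<close>)
    fix x s assume x: "x \<in> {0<..<\<delta>}" and s: "s \<in> {0..K}"
    have "T (a + s) g = T a (T s g)"
      using C0_semigroup_add[OF assms(1), of a s] \<open>a > 0\<close> s by simp
    then have "norm (S x (T (a + s) g) - T x (T (a + s) g)) = x * norm (B x (T s g))"
      using x by (simp add: B_apply)
    also have "\<dots> \<le> e * x"
      using \<delta>[of x s] x s by (simp add: mult.commute)
    finally show "norm (S x (T (a + s) g) - T x (T (a + s) g)) \<le> e * x" .
  qed
qed

text \<open>The telescoping sum, built by peeling off the rightmost factor, which acts first. The
  constraints on \<open>s\<close> keep every intermediate time inside \<open>{a..a+K}\<close>, where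
  the one-step error is controlled.\<close>

lemma prod_list_error_bound:
  assumes "C0_semigroup T"
    and M: "\<And>xs. set xs \<subseteq> {0<..<\<delta>} \<Longrightarrow> sum_list xs \<le> K \<Longrightarrow> norm (blinfun_prod_list S xs) \<le> M"
    and e: "\<And>x s. x \<in> {0<..<\<delta>} \<Longrightarrow> s \<in> {a..a+K} \<Longrightarrow> norm (S x (T s g) - T x (T s g)) \<le> e * x"
    and "a \<ge> 0" "set xs \<subseteq> {0<..<\<delta>}" "s \<ge> a" "s + sum_list xs \<le> a + K"
  shows "norm (blinfun_prod_list S xs (T s g) - T (sum_list xs + s) g) \<le> M * (e * sum_list xs)"
  using assms(5-)
proof (induction xs arbitrary: s rule: rev_induct)
  case Nil
  then show ?case by simp
next
  case (snoc x xs)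
  let ?P = "blinfun_prod_list S xs"
  have x: "x \<in> {0<..<\<delta>}" and xs: "set xs \<subseteq> {0<..<\<delta>}"
    using snoc.prems by auto
  have sum: "sum_list xs \<ge> 0"
    using xs by (intro sum_list_nonneg) auto
  have s: "s \<in> {a..a+K}" and K: "sum_list xs \<le> K"
    using snoc.prems x sum by auto
  have "T x (T s g) = T (x + s) g"
    using C0_semigroup_add[OF assms(1), of x s] x s \<open>a \<ge> 0\<close> by simp
  \<comment> \<open>Inserting \<open>T x\<close> in place of \<open>S x\<close> in the first step
    leaves a one-step error under the stable product \<open>?P\<close>, plus the same problem for
    \<open>xs\<close> started at time \<open>x + s\<close>.\<close>
  then have "blinfun_prod_list S (xs @ [x]) (T s g) - T (sum_list (xs @ [x]) + s) g =
      ?P (S x (T s g) - T x (T s g)) + (?P (T (x + s) g) - T (sum_list xs + (x + s)) g)"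
    by (simp add: blinfun_prod_list_append blinfun.diff_right add.assoc)
  moreover have "norm (?P (S x (T s g) - T x (T s g))) \<le> M * (e * x)"
    by (rule order.trans[OF norm_blinfun])
      (use M[OF xs K] e[OF x s] in \<open>auto intro!: mult_mono order.trans[OF norm_ge_zero]\<close>)
  moreover have "norm (?P (T (x + s) g) - T (sum_list xs + (x + s)) g) \<le> M * (e * sum_list xs)"
    using snoc.prems x by (intro snoc.IH) auto
  ultimately show ?case
    by (simp add: distrib_left norm_triangle_le)
qed

text \<open>Stated for any consistent and stable \<open>S\<close>, since it serves both proper
  families and the uniqueness of the semigroup. The gap \<open>t < K\<close> makes the sums
  eventually at most \<open>K\<close>.\<close>

lemma prod_list_tendsto_semigroup:
  fixes S T :: "real \<Rightarrow> 'a::banach \<Rightarrow>\<^sub>L 'a" and xs :: "nat \<Rightarrow> real list"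
  assumes T: "C0_semigroup T" and S: "strongly_continuous S" "consistent_with S T"
    and stable: "stable_up_to S K" and "t < K"
    and pos: "\<And>n x. x \<in> set (xs n) \<Longrightarrow> 0 < x"
    and sum: "(\<lambda>n. sum_list (xs n)) \<longlonglongrightarrow> t"
    and mesh: "\<And>\<delta>. \<delta> > 0 \<Longrightarrow> eventually (\<lambda>n. \<forall>x\<in>set (xs n). x < \<delta>) sequentially"
  shows "(\<lambda>n. blinfun_prod_list S (xs n) f) \<longlonglongrightarrow> T t f"
proof -
  have sum_ge_0: "sum_list (xs n) \<ge> 0" for n
    by (intro sum_list_nonneg) (use pos less_imp_le in blast)
  then have "t \<ge> 0"
    using sum by (intro LIMSEQ_le_const) auto
  obtain \<delta> M where "\<delta> > 0"
    and M: "\<And>ys. set ys \<subseteq> {0<..<\<delta>} \<Longrightarrow> sum_list ys \<le> K \<Longrightarrow> norm (blinfun_prod_list S ys) \<le> M"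
    using stable unfolding stable_up_to_def by blast
  \<comment> \<open>The empty product is covered by the stability bound because its sum 0 is at most
    \<open>K\<close>.\<close>
  have "M \<ge> 0"
    using order.trans[OF norm_ge_zero M[of "[]"]] \<open>t \<ge> 0\<close> \<open>t < K\<close> by simp
  have ev_K: "eventually (\<lambda>n. sum_list (xs n) \<le> K) sequentially"
    using order_tendstoD(2)[OF sum \<open>t < K\<close>] by eventually_elim simp
  have ev_M: "eventually (\<lambda>n. norm (blinfun_prod_list S (xs n)) \<le> M) sequentially"
    using mesh[OF \<open>\<delta> > 0\<close>] ev_K
  proof eventually_elim
    case (elim n)
    then show ?case
      using pos by (intro M) auto
  qed
  have T_lim: "(\<lambda>n. T (sum_list (xs n) + s) g) \<longlonglongrightarrow> T (t + s) g" if "s \<ge> 0" for s g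
    by (rule continuous_on_tendsto_compose[OF C0_semigroup_continuous_on[OF T, of g]])
      (use that \<open>t \<ge> 0\<close> sum_ge_0 in \<open>auto intro!: tendsto_intros sum\<close>)
  have on_range: "(\<lambda>n. blinfun_prod_list S (xs n) (T a g)) \<longlonglongrightarrow> T (t + a) g" if "a > 0" for a g
  proof -
    \<comment> \<open>The telescoping estimate compares with the semigroup at the actual sum of the
      steps; \<open>T_lim\<close> then replaces that sum by \<open>t\<close>.\<close>
    have "(\<lambda>n. blinfun_prod_list S (xs n) (T a g) - T (sum_list (xs n) + a) g) \<longlonglongrightarrow> 0"
    proof (rule tendstoI)
      fix e :: real assume "e > 0"
      \<comment> \<open>Chosen so that \<open>M * (e' * sum_list (xs n))\<close> falls below
        \<open>e\<close>; the added ones make the factors positive and the inequality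
        strict.\<close>
      define e' where "e' = e / ((M + 1) * (\<bar>K\<bar> + 1))"
      have "e' > 0"
        using \<open>e > 0\<close> \<open>M \<ge> 0\<close> by (simp add: e'_def)
      obtain \<delta>' where "\<delta>' > 0" and \<delta>': "\<And>x s. x \<in> {0<..<\<delta>'} \<Longrightarrow> s \<in> {0..K} \<Longrightarrow>
          norm (S x (T (a + s) g) - T x (T (a + s) g)) \<le> e' * x"
        using consistent_uniformly_on_orbit[OF T S \<open>a > 0\<close> \<open>e' > 0\<close>] by blast
      have "min \<delta> \<delta>' > 0"
        using \<open>\<delta> > 0\<close> \<open>\<delta>' > 0\<close> by simp
      show "eventually (\<lambda>n. dist (blinfun_prod_list S (xs n) (T a g) - T (sum_list (xs n) + a) g) 0 < e)
          sequentially"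
        using mesh[OF \<open>min \<delta> \<delta>' > 0\<close>] ev_K
      proof eventually_elim
        case (elim n)
        have "norm (blinfun_prod_list S (xs n) (T a g) - T (sum_list (xs n) + a) g)
            \<le> M * (e' * sum_list (xs n))"
        proof (rule prod_list_error_bound[where \<delta> = "min \<delta> \<delta>'" and K = K and a = a, OF T])
          show "norm (S x (T s g) - T x (T s g)) \<le> e' * x"
            if "x \<in> {0<..<min \<delta> \<delta>'}" "s \<in> {a..a + K}" for x s
            using \<delta>'[of x "s - a"] that by auto
          show "norm (blinfun_prod_list S ys) \<le> M"
            if "set ys \<subseteq> {0<..<min \<delta> \<delta>'}" "sum_list ys \<le> K" for ys
            using that by (intro M) auto
        qed (use elim pos \<open>a > 0\<close> in auto)
        also have "\<dots> \<le> M * (e' * (\<bar>K\<bar> + 1))"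
          using elim(2) \<open>M \<ge> 0\<close> \<open>e' > 0\<close> by (intro mult_left_mono) auto
        also have "\<dots> < (M + 1) * (e' * (\<bar>K\<bar> + 1))"
          using \<open>e' > 0\<close> by (intro mult_strict_right_mono) auto
        also have "\<dots> = e"
          using \<open>M \<ge> 0\<close> by (simp add: e'_def)
        finally show ?case
          by simp
      qed
    qed
    from tendsto_add[OF this T_lim[of a g]] \<open>a > 0\<close> show ?thesis
      by simp
  qed
  show ?thesis
  proof (rule tendstoI)
    fix e :: real assume "e > 0"
    \<comment> \<open>Replacing \<open>f\<close> by \<open>T a f\<close> costs at most
      \<open>M\<close> times the distance in the product and \<open>norm (T t)\<close> times it in
      the limit; the 1 ensures \<open>C > 0\<close>.\<close>
    define C where "C = M + norm (T t) + 1"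
    have "C > 0"
      using \<open>M \<ge> 0\<close> by (simp add: C_def add_nonneg_pos)
    \<comment> \<open>Density of the ranges: strong continuity at 0 approximates \<open>f\<close> by
      vectors \<open>T a f\<close> with \<open>a > 0\<close>.\<close>
    have "((\<lambda>a. T a f) \<longlongrightarrow> T 0 f) (at_right 0)"
      by (rule tendsto_within_subset[of _ _ 0 "{0..}"])
        (use C0_semigroup_continuous_on[OF T, of f] in \<open>auto simp: continuous_on_def\<close>)
    then have "eventually (\<lambda>a. dist (T a f) f < e / (2 * C)) (at_right 0)"
      using \<open>e > 0\<close> \<open>C > 0\<close> by (simp add: tendsto_iff C0_semigroup_0[OF T])
    then obtain b where "b > 0" and b: "\<And>a. 0 < a \<Longrightarrow> a < b \<Longrightarrow> norm (T a f - f) < e / (2 * C)"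
      unfolding eventually_at_right_field dist_norm by blast
    define a where "a = b / 2"
    have "a > 0" and a: "norm (T a f - f) < e / (2 * C)"
      using \<open>b > 0\<close> b[of a] by (simp_all add: a_def)
    have T_ta: "T (t + a) f = T t (T a f)"
      using C0_semigroup_add[OF T, of t a] \<open>t \<ge> 0\<close> \<open>a > 0\<close> by simp
    have "eventually (\<lambda>n. norm (blinfun_prod_list S (xs n) (T a f) - T (t + a) f) < e / 2) sequentially"
      using tendstoD[OF on_range[OF \<open>a > 0\<close>, of f], of "e / 2"] \<open>e > 0\<close> by (simp add: dist_norm)
    then show "eventually (\<lambda>n. dist (blinfun_prod_list S (xs n) f) (T t f) < e) sequentially"
      using ev_M
    proof eventually_elim
      case (elim n)
      let ?P = "blinfun_prod_list S (xs n)"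
      have "?P f - T t f = (?P (T a f) - T (t + a) f) + (T t (T a f - f) - ?P (T a f - f))"
        by (simp add: T_ta blinfun.diff_right)
      then have "norm (?P f - T t f) \<le>
          norm (?P (T a f) - T (t + a) f) + (norm (T t (T a f - f)) + norm (?P (T a f - f)))"
        by (simp only: order.trans[OF norm_triangle_ineq add_left_mono[OF norm_triangle_ineq4]])
      moreover have "norm (T t (T a f - f)) + norm (?P (T a f - f)) \<le> C * norm (T a f - f)"
        using norm_blinfun[of "T t" "T a f - f"] norm_blinfun[of ?P "T a f - f"]
          mult_right_mono[OF elim(2) norm_ge_zero[of "T a f - f"]] norm_ge_zero[of "T a f - f"]
        unfolding C_def distrib_right by linarith
      moreover have "C * norm (T a f - f) < e / 2"
        using a \<open>C > 0\<close> by (simp add: field_simps)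
      ultimately show ?case
        using elim(1) unfolding dist_norm by linarith
    qed
  qed
qed

section \<open>Criteria for consistency and stability, and uniqueness of the semigroup\<close>

lemma consistent_withI:
  fixes S T :: "real \<Rightarrow> 'a::banach \<Rightarrow>\<^sub>L 'a"
  assumes "\<And>a g. a > 0 \<Longrightarrow> \<exists>h. ((\<lambda>x. (S x (T a g) - T a g) /\<^sub>R x) \<longlongrightarrow> h) (at_right 0) \<and>
      ((\<lambda>x. (T x (T a g) - T a g) /\<^sub>R x) \<longlongrightarrow> h) (at_right 0)"
  shows "consistent_with S T"
  unfolding consistent_with_def
proof (intro allI impI)
  fix a :: real and g
  assume "a > 0"
  then obtain h where h: "((\<lambda>x. (S x (T a g) - T a g) /\<^sub>R x) \<longlongrightarrow> h) (at_right 0)"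
      "((\<lambda>x. (T x (T a g) - T a g) /\<^sub>R x) \<longlongrightarrow> h) (at_right 0)"
    using assms by blast
  show "((\<lambda>x. (S x (T a g) - T x (T a g)) /\<^sub>R x) \<longlongrightarrow> 0) (at_right 0)"
    using tendsto_diff[OF h] by (simp flip: scaleR_diff_right)
qed

text \<open>A product of semigroup operators collapses to a single one, at a time in
  \<open>{0..K}\<close>, where the norms are bounded.\<close>

lemma C0_semigroup_stable:
  assumes "C0_semigroup T"
  shows "stable_up_to T K"
proof -
  obtain M where M: "\<forall>t\<in>{0..K}. norm (T t) \<le> M"
    using C0_semigroup_locally_bounded[OF assms] by blast
  have "norm (blinfun_prod_list T xs) \<le> M"
    if xs: "set xs \<subseteq> {0<..<1} \<and> sum_list xs \<le> K" for xs
  proof -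
    have "\<And>x. x \<in> set xs \<Longrightarrow> 0 \<le> x"
      using xs by force
    then show ?thesis
      using M xs C0_semigroup_prod_list[OF assms, of xs] sum_list_nonneg[of xs] by auto
  qed
  then show ?thesis
    unfolding stable_up_to_def using zero_less_one by blast
qed

text \<open>Each factor has norm at most \<open>1 + c * x\<close>, hence at most
  \<open>exp (c * x)\<close>, and exponentials multiply to one that depends only on the total
  time.\<close>

lemma proper_family_stable:
  assumes "(\<lambda>t. norm (S t) - 1) \<in> O[at_right 0](\<lambda>t::real. t)"
  shows "stable_up_to S K"
proof -
  obtain c where "c > 0"
    and "eventually (\<lambda>t. norm (norm (S t) - 1) \<le> c * norm t) (at_right 0)"
    using assms by (rule landau_o.bigE)
  then obtain \<delta> where "\<delta> > 0" and \<delta>: "\<And>t. 0 < t \<Longrightarrow> t < \<delta> \<Longrightarrow> norm (norm (S t) - 1) \<le> c * norm t"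
    unfolding eventually_at_right_field by blast
  have bound: "norm (blinfun_prod_list S xs) \<le> exp (c * sum_list xs)" if "set xs \<subseteq> {0<..<\<delta>}" for xs
    using that
  proof (induction xs)
    case Nil
    then show ?case by (simp add: norm_blinfun_id_le)
  next
    case (Cons x xs)
    have "norm (S x) \<le> 1 + c * x"
      using \<delta>[of x] Cons.prems by auto
    also have "\<dots> \<le> exp (c * x)"
      by simp
    finally have "norm (S x) * norm (blinfun_prod_list S xs) \<le> exp (c * x) * exp (c * sum_list xs)"
      using Cons by (intro mult_mono) auto
    then show ?case
      using norm_blinfun_compose[of "S x" "blinfun_prod_list S xs"]
      by (simp add: distrib_left exp_add)
  qed
  have "norm (blinfun_prod_list S xs) \<le> exp (c * K)"
    if "set xs \<subseteq> {0<..<\<delta>} \<and> sum_list xs \<le> K" for xs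
    using that \<open>c > 0\<close> by (intro order.trans[OF bound]) auto
  then show ?thesis
    unfolding stable_up_to_def using \<open>\<delta> > 0\<close> by blast
qed

text \<open>Cutting \<open>t\<close> into equal steps gives products of \<open>T\<close> that all
  equal \<open>T t\<close> but converge to \<open>T' t\<close>.\<close>

lemma C0_semigroup_unique:
  assumes "C0_semigroup T" "C0_semigroup T'" "consistent_with T T'" "t \<ge> 0"
  shows "T t = T' t"
proof (rule blinfun_eqI)
  fix f
  define xs where "xs n = replicate (Suc n) (t / real (Suc n))" for n
  have sum_xs: "sum_list (xs n) = t" for n
    by (simp add: xs_def sum_list_replicate del: replicate_Suc)
  show "T t f = T' t f"
  \<comment> \<open>The convergence lemma needs strictly positive steps, so time 0 is treated
    apart.\<close>
  proof (cases "t = 0")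
    case True
    then show ?thesis
      using assms(1,2) by (simp add: C0_semigroup_0)
  next
    case False
    have pos: "0 < x" if "x \<in> set (xs n)" for n x
      using that False \<open>t \<ge> 0\<close> by (auto simp: xs_def simp del: replicate_Suc)
    have "(\<lambda>n. blinfun_prod_list T (xs n) f) \<longlonglongrightarrow> T' t f"
    proof (rule prod_list_tendsto_semigroup[where K = "t + 1"])
      show "strongly_continuous T"
        using assms(1) by (simp add: C0_semigroup_def)
      fix \<delta> :: real assume "\<delta> > 0"
      have "(\<lambda>n. t / real (Suc n)) \<longlonglongrightarrow> 0"
        by (rule LIMSEQ_Suc[OF lim_const_over_n])
      from order_tendstoD(2)[OF this \<open>\<delta> > 0\<close>]
      show "eventually (\<lambda>n. \<forall>x\<in>set (xs n). x < \<delta>) sequentially"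
        by (simp add: xs_def del: replicate_Suc)
    qed (use assms C0_semigroup_stable pos in \<open>auto simp: sum_xs\<close>)
    moreover have "blinfun_prod_list T (xs n) = T t" for n
      by (subst C0_semigroup_prod_list[OF assms(1)]) (auto simp: sum_xs intro: less_imp_le dest: pos)
    ultimately show ?thesis
      by (simp add: LIMSEQ_const_iff)
  qed
qed

section \<open>Convergence of products of a proper family\<close>

theorem proposition1:
  fixes S T :: "real \<Rightarrow> 'a::banach \<Rightarrow>\<^sub>L 'a"
    and A :: "('a \<times> 'a) set"
    and \<tau> :: "nat \<Rightarrow> nat \<Rightarrow> real"
    and r :: "nat \<Rightarrow> nat"
    and t :: real
    and f :: 'a
  assumes "proper_family S"
    and "has_D S A"
    and "generates A T"
    and "\<And>n i. 1 \<le> i \<Longrightarrow> i \<le> r n \<Longrightarrow> \<tau> n i > 0"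
    and "t \<ge> 0"
    and "(\<lambda>n. \<Sum>i = 1..r n. \<tau> n i) \<longlonglongrightarrow> t"
    and "(\<lambda>n. Max (\<tau> n ` {1..r n})) \<longlonglongrightarrow> 0"
  shows "(\<lambda>n. op_product S (\<tau> n) (r n) f) \<longlonglongrightarrow> T t f"
proof -
  \<comment> \<open>The witness \<open>T'\<close> hidden in \<open>has_D\<close> is a priori
    different from \<open>T\<close>; they share only the generator \<open>A\<close>.\<close>
  obtain T' where T': "C0_semigroup T'" "generator T' = A"
    and D: "\<And>a g. a > 0 \<Longrightarrow>
      \<exists>h. (T' a g, h) \<in> A \<and> ((\<lambda>x. (S x (T' a g) - T' a g) /\<^sub>R x) \<longlongrightarrow> h) (at_right 0)"
    using assms(2) unfolding has_D_def generates_def by blast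
  have T: "C0_semigroup T" "generator T = A"
    using assms(3) by (auto simp: generates_def)
  have S: "strongly_continuous S" "(\<lambda>t. norm (S t) - 1) \<in> O[at_right 0](\<lambda>t. t)"
    using assms(1) by (auto simp: proper_family_def)
  have generatorD: "((\<lambda>x. (U x k - k) /\<^sub>R x) \<longlongrightarrow> h) (at_right 0)"
    if "(k, h) \<in> A" "generator U = A" for U k h
    using that by (auto simp: generator_def)
  \<comment> \<open>On the range of \<open>T' a\<close>, the difference quotients of
    \<open>S\<close>, \<open>T\<close> and \<open>T'\<close> all tend to the value given by
    \<open>A\<close>.\<close>
  have "consistent_with T T'" "consistent_with S T'"
    by (rule consistent_withI; use D generatorD T(2) T'(2) in blast)+
  define xs where "xs n = map (\<tau> n) [1..<Suc (r n)]" for n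
  have set_xs: "set (xs n) = \<tau> n ` {1..r n}" for n
    by (auto simp: xs_def)
  have sum_xs: "sum_list (xs n) = (\<Sum>i = 1..r n. \<tau> n i)" for n
    unfolding xs_def by (subst sum_list_distinct_conv_sum_set) (auto intro!: sum.cong)
  have "(\<lambda>n. blinfun_prod_list S (xs n) f) \<longlonglongrightarrow> T' t f"
  proof (rule prod_list_tendsto_semigroup[where K = "t + 1", OF T'(1) S(1) \<open>consistent_with S T'\<close>
        proper_family_stable[OF S(2)]])
    fix \<delta> :: real assume "\<delta> > 0"
    show "eventually (\<lambda>n. \<forall>x\<in>set (xs n). x < \<delta>) sequentially"
      using order_tendstoD(2)[OF assms(7) \<open>\<delta> > 0\<close>]
    proof eventually_elim
      case (elim n)
      show ?case
      proof
        \<comment> \<open>If \<open>r n = 0\<close>, the \<open>Max\<close> is unspecified, but then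
          there is no \<open>x\<close> to check.\<close>
        fix x assume "x \<in> set (xs n)"
        then have "x \<le> Max (\<tau> n ` {1..r n})"
          unfolding set_xs by (intro Max_ge) auto
        then show "x < \<delta>"
          using elim by linarith
      qed
    qed
  qed (use assms(4,6) in \<open>auto simp: set_xs sum_xs\<close>)
  then show ?thesis
    using C0_semigroup_unique[OF T(1) T'(1) \<open>consistent_with T T'\<close> \<open>t \<ge> 0\<close>]
    by (simp add: op_product_eq_blinfun_prod_list xs_def)
qed

end
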